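(* Let $r>u\ge 2$ be integers and $t\ge s\ge \max\left(\binom{r}{2},2r-2\right)$. Then there exists a constant $C_{u,r}>0$ such that for all sufficiently large $p$, $$\mathrm{ex}_u(p,K_r,K_{s,t})\ge C_{u,r}\,p^{\frac{2rst-r(r-1)(s+t)-r(r-1)(r-2)}{2ust-u(u-1)(s+t)-ur(r-1)+2u(u-1)}}.$$
   Context: All graphs are finite and simple. $\mathrm{ex}_u(p,K_r,F)$ is the maximum number of copies of $K_r$ in an $F$-free graph containing exactly $p$ copies of $K_u$. $K_{s,t}$ is the complete bipartite graph with parts of sizes $s$ and $t$. *)

theory Defs
  imports Complex_Main "Graph_Theory.Kuratowski"
begin

text \<open>
  Finite simple graphs are the \<^locale>\<open>pair_graph\<close>s, i.e. the finite, loopfree, symmetric digraphs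
  without parallel arcs (an edge is a pair of opposite arcs).  A graph \<open>F\<close> is given by its
  isomorphism class, such as \<^term>\<open>complete_digraph r\<close> for \<open>K\<^sub>r\<close>.  A copy of \<open>F\<close> in \<open>G\<close> is a not
  necessarily induced subgraph of \<open>G\<close> in that class, so copies are unlabelled.
\<close>

definition copies ::
  "(('a, 'a \<times> 'a) pre_digraph \<Rightarrow> bool) \<Rightarrow> 'a pair_pre_digraph \<Rightarrow> 'a pair_pre_digraph set" where
  "copies F G = {H. subgraph (with_proj H) (with_proj G) \<and> F (with_proj H)}"

definition free_of ::
  "(('a, 'a \<times> 'a) pre_digraph \<Rightarrow> bool) \<Rightarrow> 'a pair_pre_digraph \<Rightarrow> bool" where
  "free_of F G \<longleftrightarrow> copies F G = {}"

text \<open>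
  \<open>clique_ex u p r F\<close> is $\mathrm{ex}_u(p, K_r, F)$.  Every finite graph is isomorphic to one with
  vertices in \<^typ>\<open>nat\<close>.  The number of vertices is not bounded, but for \<open>1 \<le> u \<le> r\<close> each
  vertex of a \<open>K\<^sub>r\<close> lies in one of the \<open>p\<close> copies of \<open>K\<^sub>u\<close>, so the set below is finite; it is
  nonempty when \<open>F\<close> is connected and has more than \<open>u\<close> vertices (take \<open>p\<close> disjoint copies of \<open>K\<^sub>u\<close>).
\<close>

definition clique_ex ::
  "nat \<Rightarrow> nat \<Rightarrow> nat \<Rightarrow> ((nat, nat \<times> nat) pre_digraph \<Rightarrow> bool) \<Rightarrow> nat" where
  "clique_ex u p r F =
     Max {card (copies (complete_digraph r) G) | G :: nat pair_pre_digraph.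
            pair_graph G \<and> free_of F G \<and> card (copies (complete_digraph u) G) = p}"

end

theory Submission
  imports Defs "HOL-Real_Asymp.Real_Asymp"
begin

text \<open>
  Deletion method: take a random graph on \<open>n\<close> vertices with edge probability \<open>1 / m\<close>, where \<open>n\<close> is
  about \<open>m powr \<alpha>\<close>, and delete every edge that lies in a \<open>K\<^sub>s\<^sub>,\<^sub>t\<close>.  Given that an \<open>r\<close>-set \<open>A\<close> is
  a clique, a copy of \<open>K\<^sub>s\<^sub>,\<^sub>t\<close> meeting \<open>A\<close> in \<open>j \<ge> 2\<close> vertices adds at least \<open>s t - (j choose 2)\<close>
  further edges.  So such copies are unlikely as soon as
  \<open>\<alpha> (s + t - j) < s t - (j choose 2)\<close> for \<open>2 \<le> j \<le> r\<close>; the value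
  \<open>\<alpha>\<^sub>0 = (s t - (r choose 2)) / (s + t - 2)\<close> satisfies this strictly.  Hence \<open>A\<close> survives with
  probability at least 1/2, even jointly with the event that the number of copies of \<open>K\<^sub>u\<close> is of
  the expected order \<open>m powr (u \<alpha> - (u choose 2))\<close>, while the expected number of surviving \<open>K\<^sub>r\<close>
  is of order \<open>m powr (r \<alpha> - (r choose 2))\<close>.  The exponent of the theorem is
  \<open>(r \<alpha> - (r choose 2)) / (u \<alpha> - (u choose 2))\<close> at \<open>\<alpha> = \<alpha>\<^sub>0\<close>.  Disjoint copies of \<open>K\<^sub>u\<close> pad the
  graph to exactly \<open>p\<close> of them.
\<close>

section \<open>Cliques and bicliques\<close>

definition cliques :: "nat \<Rightarrow> 'a pair_pre_digraph \<Rightarrow> 'a set set" where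
  "cliques k G = {A. A \<subseteq> pverts G \<and> card A = k \<and> (\<forall>x\<in>A. \<forall>y\<in>A. x \<noteq> y \<longrightarrow> (x, y) \<in> parcs G)}"

text \<open>Only arcs from \<open>U\<close> to \<open>V\<close> are demanded. In a symmetric digraph
  the reverse arcs follow, so this is containment of a not necessarily induced complete bipartite
  graph.\<close>

definition has_biclique :: "nat \<Rightarrow> nat \<Rightarrow> 'a pair_pre_digraph \<Rightarrow> bool" where
  "has_biclique s t G \<longleftrightarrow> (\<exists>U V. U \<subseteq> pverts G \<and> V \<subseteq> pverts G \<and> U \<inter> V = {} \<and>
      card U = s \<and> card V = t \<and> U \<times> V \<subseteq> parcs G)"

lemma pair_graph_arcsD:
  assumes "pair_graph G" "(x, y) \<in> parcs G"
  shows "x \<in> pverts G" "y \<in> pverts G" "x \<noteq> y" "(y, x) \<in> parcs G"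
proof -
  interpret pair_graph G by fact
  show "x \<in> pverts G" "y \<in> pverts G"
    using assms(2) arc_fst_in_verts arc_snd_in_verts by force+
  show "x \<noteq> y" using assms(2) pair_no_loops by force
  show "(y, x) \<in> parcs G"
    using assms(2) pair_sym_arcs unfolding symmetric_def by (auto dest: symD)
qed

lemma pair_graphI:
  assumes "finite (pverts G)"
    and "\<And>x y. (x, y) \<in> parcs G \<Longrightarrow> x \<in> pverts G \<and> x \<noteq> y \<and> (y, x) \<in> parcs G"
  shows "pair_graph G"
proof -
  have sub: "parcs G \<subseteq> pverts G \<times> pverts G" using assms(2) by auto
  then have "finite (parcs G)" using assms(1) finite_subset by blast
  moreover have "symmetric (with_proj G)"
    unfolding symmetric_def using assms(2) by (auto intro: symI)
  ultimately show ?thesis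
    using assms sub by unfold_locales auto
qed

lemma finite_pverts: "pair_graph G \<Longrightarrow> finite (pverts G)"
  by (simp add: pair_graph_def pair_digraph_def pair_fin_digraph_def pair_fin_digraph_axioms_def)

lemma finite_cliques: "finite (pverts G) \<Longrightarrow> finite (cliques k G)"
  unfolding cliques_def by (rule finite_subset[of _ "Pow (pverts G)"]) auto

text \<open>A complete subgraph contains every arc between its vertices, so its vertex set
  determines it. Counting copies thus becomes counting vertex sets.\<close>

lemma bij_betw_copies_cliques:
  assumes "pair_graph G"
  shows "bij_betw pverts (copies (complete_digraph k) G) (cliques k G)"
proof (rule bij_betw_imageI)
  show "inj_on pverts (copies (complete_digraph k) G)"
    by (auto simp: inj_on_def copies_def complete_digraph_pair_def)
  show "pverts ` copies (complete_digraph k) G = cliques k G"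
  proof (intro equalityI subsetI)
    fix A assume "A \<in> pverts ` copies (complete_digraph k) G"
    then show "A \<in> cliques k G"
      by (auto simp: copies_def complete_digraph_pair_def cliques_def subgraph_def)
  next
    fix A assume A: "A \<in> cliques k G"
    define H where "H = \<lparr>pverts = A, parcs = {(x, y). x \<in> A \<and> y \<in> A \<and> x \<noteq> y}\<rparr>"
    have "finite A" using A finite_pverts[OF assms] by (auto simp: cliques_def intro: finite_subset)
    then have "complete_digraph k (with_proj H)"
      using A by (auto simp: complete_digraph_pair_def H_def cliques_def)
    moreover have "wf_digraph (with_proj G)" "wf_digraph (with_proj H)"
      using pair_graph_arcsD[OF assms] by (unfold_locales; auto simp: H_def)+
    then have "subgraph (with_proj H) (with_proj G)"
      using A by (auto simp: subgraph_def H_def cliques_def compatible_def)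
    ultimately show "A \<in> pverts ` copies (complete_digraph k) G"
      unfolding copies_def by (intro image_eqI[of _ _ H]) (auto simp: H_def)
  qed
qed

lemma card_copies_complete:
  "pair_graph G \<Longrightarrow> card (copies (complete_digraph k) G) = card (cliques k G)"
  by (rule bij_betw_same_card[OF bij_betw_copies_cliques])

lemma free_of_bipartiteI:
  assumes "\<not> has_biclique s t G"
  shows "free_of (complete_bipartite_digraph s t) G"
  unfolding free_of_def
proof (rule equals0I)
  fix H assume "H \<in> copies (complete_bipartite_digraph s t) G"
  then obtain U V where "pverts H \<subseteq> pverts G" "parcs H \<subseteq> parcs G" "pverts H = U \<union> V"
    "U \<inter> V = {}" "card U = s" "card V = t" "parcs H = U \<times> V \<union> V \<times> U"
    by (auto simp: copies_def subgraph_def complete_bipartite_digraph_pair_def)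
  then have "has_biclique s t G"
    unfolding has_biclique_def by (intro exI[of _ U] exI[of _ V]) auto
  then show False using assms by simp
qed

section \<open>From a single graph to a lower bound on \<open>clique_ex\<close>\<close>

text \<open>This makes the set under \<open>Max\<close> in \<open>clique_ex\<close> finite. Every
  vertex of an \<open>r\<close>-clique lies in a \<open>u\<close>-clique, so all
  \<open>r\<close>-cliques are subsets of the union \<open>W\<close> of the
  \<open>u\<close>-cliques.\<close>

lemma card_cliques_le:
  assumes "1 \<le> u" "u \<le> r" and fin: "finite (pverts G)"
  shows "card (cliques r G) \<le> 2 ^ (card (cliques u G) * u)"
proof -
  define W where "W = \<Union> (cliques u G)"
  have card_W: "card W \<le> card (cliques u G) * u"
    unfolding W_def using card_Union_le_sum_card[of "cliques u G"]
    by (simp add: cliques_def)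
  have finW: "finite W"
    unfolding W_def using fin by (rule finite_subset[rotated]) (auto simp: cliques_def)
  have "cliques r G \<subseteq> Pow W"
  proof clarify
    fix A x assume A: "A \<in> cliques r G" and x: "x \<in> A"
    have "finite A" using A fin by (auto simp: cliques_def intro: finite_subset)
    then have "u - 1 \<le> card (A - {x})" using A x assms by (auto simp: cliques_def)
    then obtain B where "B \<subseteq> A - {x}" "card B = u - 1" "finite B"
      by (rule obtain_subset_with_card_n)
    then have "card (insert x B) = u" "insert x B \<subseteq> A"
      using assms x by (auto simp: card_insert_if)
    then have "insert x B \<in> cliques u G"
      using A unfolding cliques_def by blast
    then show "x \<in> W" unfolding W_def by blast
  qed
  then have "card (cliques r G) \<le> card (Pow W)"
    using finW by (intro card_mono) auto
  also have "\<dots> \<le> 2 ^ (card (cliques u G) * u)"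
    using card_W finW by (simp add: card_Pow)
  finally show ?thesis .
qed

lemma clique_ex_ge:
  fixes G :: "nat pair_pre_digraph"
  assumes "1 \<le> u" "u \<le> r" and G: "pair_graph G" "\<not> has_biclique s t G" "card (cliques u G) = p"
  shows "card (cliques r G) \<le> clique_ex u p r (complete_bipartite_digraph s t)"
  unfolding clique_ex_def
proof (rule Max_ge)
  show "finite {card (copies (complete_digraph r) G) | G :: nat pair_pre_digraph.
      pair_graph G \<and> free_of (complete_bipartite_digraph s t) G \<and>
      card (copies (complete_digraph u) G) = p}"
    by (rule finite_subset[of _ "{..2 ^ (p * u)}"])
      (auto simp: card_copies_complete intro!: card_cliques_le[OF assms(1,2)] finite_pverts)
  show "card (cliques r G) \<in> {card (copies (complete_digraph r) G) | G :: nat pair_pre_digraph.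
      pair_graph G \<and> free_of (complete_bipartite_digraph s t) G \<and>
      card (copies (complete_digraph u) G) = p}"
    using G free_of_bipartiteI[OF G(2)] by (auto simp: card_copies_complete intro!: exI[of _ G])
qed

text \<open>The new \<open>u\<close>-clique \<open>B\<close> is placed on fresh vertices. Cliques
  and bicliques are connected, so each lies inside \<open>B\<close> or avoids it; \<open>B\<close>
  itself is the only new \<open>u\<close>-clique, and it is too small for a biclique because
  \<open>u < s + t\<close>.\<close>

lemma add_disjoint_clique:
  fixes G :: "nat pair_pre_digraph"
  assumes u: "2 \<le> u" and st: "1 \<le> s" "1 \<le> t" "u < s + t"
    and G: "pair_graph G" "\<not> has_biclique s t G"
  obtains G' :: "nat pair_pre_digraph" where "pair_graph G'" "\<not> has_biclique s t G'"
    "card (cliques u G') = Suc (card (cliques u G))" "card (cliques r G) \<le> card (cliques r G')"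
proof -
  note fin = finite_pverts[OF G(1)]
  obtain B where B: "finite B" "card B = u" "B \<inter> pverts G = {}"
  proof -
    have "infinite (- pverts G)" using fin by (simp add: Compl_eq_Diff_UNIV)
    then obtain B where "finite B" "card B = u" "B \<subseteq> - pverts G"
      using infinite_arbitrarily_large by blast
    then show thesis using that by blast
  qed
  define G' where "G' = \<lparr>pverts = pverts G \<union> B,
    parcs = parcs G \<union> {(x, y). x \<in> B \<and> y \<in> B \<and> x \<noteq> y}\<rparr>"
  have graph: "pair_graph G'"
    by (rule pair_graphI) (use fin B in \<open>auto simp: G'_def dest: pair_graph_arcsD[OF G(1)]\<close>)
  have adj: "x \<in> B \<longleftrightarrow> y \<in> B" if "(x, y) \<in> parcs G'" for x y
    using that B(3) by (auto simp: G'_def dest: pair_graph_arcsD(1,2)[OF G(1)])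
  have "\<not> has_biclique s t G'"
  proof
    assume "has_biclique s t G'"
    then obtain U V where UV: "U \<subseteq> pverts G'" "V \<subseteq> pverts G'" "U \<inter> V = {}"
      "card U = s" "card V = t" "U \<times> V \<subseteq> parcs G'"
      unfolding has_biclique_def by blast
    have "U \<noteq> {}" "V \<noteq> {}" "finite U" "finite V"
      using UV st fin B(1) by (auto simp: G'_def intro: card_ge_0_finite)
    then obtain x v where x: "x \<in> U" and v: "v \<in> V" by blast
    \<comment> \<open>Connectedness of the biclique: a vertex of \<open>U\<close> is linked to
      \<open>x\<close> through \<open>v\<close>, a vertex of \<open>V\<close> directly.\<close>
    have side: "y \<in> B \<longleftrightarrow> x \<in> B" if "y \<in> U \<union> V" for y
      using that x v UV(6) adj[of x y] adj[of x v] adj[of y v] by auto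
    show False
    proof (cases "x \<in> B")
      case True
      then have "card (U \<union> V) \<le> card B" using side B(1) by (intro card_mono) auto
      then show False
        using UV(3-5) B(2) st(3) card_Un_disjoint[OF \<open>finite U\<close> \<open>finite V\<close> UV(3)] by simp
    next
      case False
      then have "U \<inter> B = {}" "V \<inter> B = {}" using side by auto
      then have "U \<subseteq> pverts G" "V \<subseteq> pverts G" "U \<times> V \<subseteq> parcs G"
        using UV(1,2,6) by (auto simp: G'_def)
      then have "has_biclique s t G" using UV unfolding has_biclique_def by blast
      then show False using G(2) by simp
    qed
  qed
  moreover have "cliques u G' = insert B (cliques u G)"
  proof (intro equalityI subsetI)
    fix A assume A: "A \<in> cliques u G'"
    then have "A \<noteq> {}" using u by (auto simp: cliques_def)
    then obtain x where x: "x \<in> A" by blast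
    have side: "y \<in> B \<longleftrightarrow> x \<in> B" if "y \<in> A" for y
      using that x A adj[of y x] by (cases "y = x") (auto simp: cliques_def)
    show "A \<in> insert B (cliques u G)"
    proof (cases "x \<in> B")
      case True
      then have "A \<subseteq> B" using side by auto
      then have "A = B" using A B(1,2) by (intro card_subset_eq) (auto simp: cliques_def)
      then show ?thesis by simp
    next
      case False
      then have "A \<inter> B = {}" using side by auto
      then show ?thesis using A unfolding cliques_def G'_def by auto
    qed
  next
    fix A assume "A \<in> insert B (cliques u G)"
    then show "A \<in> cliques u G'" using B(2) by (auto simp: cliques_def G'_def)
  qed
  moreover have "B \<noteq> {}" using B(2) u by auto
  then have "B \<notin> cliques u G" using B(3) unfolding cliques_def by blast
  ultimately have "card (cliques u G') = Suc (card (cliques u G))"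
    using finite_cliques[OF fin] by simp
  moreover have "cliques r G \<subseteq> cliques r G'" by (auto simp: cliques_def G'_def)
  then have "card (cliques r G) \<le> card (cliques r G')"
    using finite_cliques finite_pverts[OF graph] by (intro card_mono) auto
  ultimately show thesis using that graph \<open>\<not> has_biclique s t G'\<close> by blast
qed

text \<open>The random construction only bounds the number of \<open>u\<close>-cliques from above.
  Induction on the deficit adds disjoint cliques until it is exactly \<open>p\<close>.\<close>

lemma clique_ex_ge_of_le:
  fixes G :: "nat pair_pre_digraph"
  assumes u: "2 \<le> u" "u \<le> r" and st: "1 \<le> s" "1 \<le> t" "u < s + t"
    and G: "pair_graph G" "\<not> has_biclique s t G" "card (cliques u G) \<le> p"
  shows "card (cliques r G) \<le> clique_ex u p r (complete_bipartite_digraph s t)"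
  using G
proof (induction "p - card (cliques u G)" arbitrary: G)
  case 0
  then show ?case using clique_ex_ge[of u r G s t p] u by auto
next
  case (Suc d)
  obtain G' :: "nat pair_pre_digraph" where G': "pair_graph G'" "\<not> has_biclique s t G'"
    "card (cliques u G') = Suc (card (cliques u G))" "card (cliques r G) \<le> card (cliques r G')"
    using add_disjoint_clique[OF u(1) st Suc.prems(1,2)] .
  then have "card (cliques r G') \<le> clique_ex u p r (complete_bipartite_digraph s t)"
    using Suc.hyps by (intro Suc.hyps(1)) auto
  then show ?case using G'(4) by simp
qed

section \<open>Counting random graphs\<close>

text \<open>Edges are two-element sets here, so a colouring treats each unordered pair once and
  symmetry is automatic.\<close>

definition pairs :: "'a set \<Rightarrow> 'a set set" where
  "pairs A = {e. e \<subseteq> A \<and> card e = 2}"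

definition cross :: "'a set \<Rightarrow> 'a set \<Rightarrow> 'a set set" where
  "cross U V = (\<lambda>(x, y). {x, y}) ` (U \<times> V)"

text \<open>
  A colouring of the pairs with \<open>m\<close> colours encodes the graph formed by the pairs of colour \<open>0\<close>, so
  a uniformly random colouring gives the random graph of edge probability \<open>1 / m\<close>.
\<close>

definition colourings_zero_on :: "nat \<Rightarrow> nat \<Rightarrow> nat set set \<Rightarrow> (nat set \<Rightarrow> nat) set" where
  "colourings_zero_on n m S = {f \<in> pairs {..<n} \<rightarrow>\<^sub>E {..<m}. \<forall>e\<in>S. f e = 0}"

lemma finite_pairs: "finite A \<Longrightarrow> finite (pairs A)"
  unfolding pairs_def by simp

lemma card_pairs: "finite A \<Longrightarrow> card (pairs A) = card A choose 2"
  unfolding pairs_def by (rule n_subsets)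

lemma pairs_mono: "A \<subseteq> B \<Longrightarrow> pairs A \<subseteq> pairs B"
  unfolding pairs_def by blast

lemma pairs_Int: "pairs A \<inter> pairs B = pairs (A \<inter> B)"
  unfolding pairs_def by blast

lemma card_cross:
  assumes "U \<inter> V = {}"
  shows "card (cross U V) = card U * card V"
proof -
  have "inj_on (\<lambda>(x, y). {x, y}) (U \<times> V)"
    using assms by (auto simp: inj_on_def doubleton_eq_iff)
  then show ?thesis unfolding cross_def by (simp add: card_image card_cartesian_product)
qed

lemma cross_subset_pairs:
  assumes "U \<inter> V = {}"
  shows "cross U V \<subseteq> pairs (U \<union> V)"
proof -
  have "card {x, y} = 2" if "x \<in> U" "y \<in> V" for x y
    using that assms by (metis card_2_iff disjoint_iff)
  then show ?thesis unfolding cross_def pairs_def by auto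
qed

lemma finite_colourings: "finite (colourings_zero_on n m S)"
  unfolding colourings_zero_on_def
  by (rule finite_subset[of _ "pairs {..<n} \<rightarrow>\<^sub>E {..<m}"]) (auto intro!: finite_PiE finite_pairs)

text \<open>Each pair in \<open>S\<close> has one admissible colour, every other pair has
  \<open>m\<close>. In probabilistic terms, \<open>S\<close> consists of edges with probability
  \<open>1 / m ^ card S\<close>; the product form stays within the naturals.\<close>

lemma card_colourings_zero_on:
  assumes "0 < m" "S \<subseteq> pairs {..<n}"
  shows "card (colourings_zero_on n m S) * m ^ card S = m ^ (n choose 2)"
proof -
  let ?P = "pairs {..<n}"
  have fin: "finite ?P" by (simp add: finite_pairs)
  have eq: "colourings_zero_on n m S = Pi\<^sub>E ?P (\<lambda>e. if e \<in> S then {0} else {..<m})"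
  proof (intro equalityI subsetI)
    fix f assume "f \<in> Pi\<^sub>E ?P (\<lambda>e. if e \<in> S then {0} else {..<m})"
    then show "f \<in> colourings_zero_on n m S"
      using assms by (fastforce simp: colourings_zero_on_def PiE_iff split: if_splits)
  qed (auto simp: colourings_zero_on_def PiE_iff)
  have "card (colourings_zero_on n m S) = (\<Prod>e\<in>?P. if e \<in> S then 1 else m)"
    unfolding eq by (subst card_PiE[OF fin]) (auto intro!: prod.cong)
  also have "\<dots> = m ^ card (?P - S)"
    using fin by (simp add: prod.If_cases Diff_eq)
  also have "\<dots> * m ^ card S = m ^ card ?P"
    using assms(2) fin card_mono[OF fin assms(2)]
    by (simp flip: power_add add: card_Diff_subset finite_subset)
  finally show ?thesis by (simp add: card_pairs)
qed

text \<open>A conditional probability: once \<open>S\<close> has colour \<open>0\<close>, only the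
  pairs of \<open>T - S\<close> cost a factor \<open>1 / m\<close> each.\<close>

lemma card_colourings_zero_on_Un:
  assumes m: "0 < m" and S: "S \<subseteq> pairs {..<n}" "T \<subseteq> pairs {..<n}" and k: "k \<le> card (T - S)"
  shows "real (card (colourings_zero_on n m (S \<union> T))) \<le> card (colourings_zero_on n m S) / real m ^ k"
proof -
  have fin: "finite S" "finite T" using S finite_pairs[of "{..<n}"] by (auto intro: finite_subset)
  have "card (S \<union> T) = card S + card (T - S)"
    using fin card_Un_disjoint[of S "T - S"] by simp
  then have "card (colourings_zero_on n m (S \<union> T)) * m ^ card (T - S) * m ^ card S
      = card (colourings_zero_on n m S) * m ^ card S"
    using card_colourings_zero_on[OF m, of "S \<union> T" n] card_colourings_zero_on[OF m S(1)] S
    by (simp add: power_add ac_simps)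
  then have "card (colourings_zero_on n m (S \<union> T)) * m ^ card (T - S)
      = card (colourings_zero_on n m S)" using m by simp
  moreover have "m ^ k \<le> m ^ card (T - S)" using m k by (simp add: power_increasing)
  ultimately have "card (colourings_zero_on n m (S \<union> T)) * m ^ k \<le> card (colourings_zero_on n m S)"
    by (metis mult_le_mono2)
  then have "real (card (colourings_zero_on n m (S \<union> T))) * real m ^ k
      \<le> real (card (colourings_zero_on n m S))"
    by (metis of_nat_le_iff of_nat_mult of_nat_power)
  then show ?thesis using m by (simp add: field_simps)
qed

section \<open>Weighted sums and the two conditional failure bounds\<close>

text \<open>The sum over subsets is the expansion of the product of the factors
  \<open>w x + 1\<close>, each of which is at most \<open>exp (w x)\<close>.\<close>

lemma sum_prod_subsets_le_exp:
  fixes w :: "'a \<Rightarrow> real"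
  assumes "finite X" "\<And>x. x \<in> X \<Longrightarrow> 0 \<le> w x"
  shows "(\<Sum>B\<in>Pow X. \<Prod>x\<in>B. w x) \<le> exp (\<Sum>x\<in>X. w x)"
proof -
  have "(\<Sum>B\<in>Pow X. \<Prod>x\<in>B. w x) = (\<Prod>x\<in>X. w x + 1)"
    using prod_add[OF assms(1), of w "\<lambda>_. 1"] by simp
  also have "\<dots> \<le> (\<Prod>x\<in>X. exp (w x))"
    using assms(2) exp_ge_add_one_self by (intro prod_mono) (auto simp: add.commute)
  also have "\<dots> = exp (\<Sum>x\<in>X. w x)" using assms(1) by (simp add: exp_sum)
  finally show ?thesis .
qed

text \<open>
  Up to constants there are \<open>n ^ (k - j)\<close> sets of size \<open>k\<close> that meet \<open>A\<close> in \<open>j\<close> points.  Weighting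
  each of them by the inverse of that number makes every \<open>j\<close> contribute \<open>O(1)\<close>, which replaces
  a case distinction on the size of the intersection.
\<close>

definition weight :: "nat \<Rightarrow> nat set \<Rightarrow> nat set \<Rightarrow> real" where
  "weight n A B = (\<Prod>x\<in>B. if x \<in> A then 1 else 1 / n)"

lemma weight_nonneg: "0 \<le> weight n A B"
  unfolding weight_def by (intro prod_nonneg) auto

lemma weight_eq:
  assumes "finite B" "0 < n"
  shows "weight n A B = real n ^ card (A \<inter> B) / real n ^ card B"
proof -
  have "weight n A B = (1 / n) ^ card (B \<inter> - A)"
    using assms(1) by (simp add: weight_def prod.If_cases)
  moreover have "card B = card (A \<inter> B) + card (B \<inter> - A)"
    using card_Un_disjoint[of "A \<inter> B" "B \<inter> - A"] assms(1)
    by (metis Int_Un_distrib Int_commute card_Int_Diff Diff_eq)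
  ultimately show ?thesis using assms(2) by (simp add: power_add power_divide)
qed

text \<open>The points of \<open>A\<close> contribute at most \<open>card A\<close> to the exponent
  and all others together at most \<open>n * (1 / n) = 1\<close>. The bound is independent of
  \<open>n\<close>.\<close>

lemma sum_weight_le:
  assumes "finite A" "0 < n"
  shows "(\<Sum>B\<in>Pow {..<n}. weight n A B) \<le> exp (1 + real (card A))"
proof -
  have "(\<Sum>x<n. if x \<in> A then 1 else 1 / real n) \<le> (\<Sum>x<n. 1 / real n + (if x \<in> A then 1 else 0))"
    by (intro sum_mono) auto
  also have "\<dots> = 1 + card ({..<n} \<inter> A)"
    using assms(2) by (simp add: sum.distrib sum.If_cases)
  also have "\<dots> \<le> 1 + card A" using assms(1) by (simp add: card_mono)
  finally have "exp (\<Sum>x<n. if x \<in> A then 1 else 1 / real n) \<le> exp (1 + real (card A))" by simp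
  then show ?thesis
    unfolding weight_def
    by (intro order.trans[OF sum_prod_subsets_le_exp]) auto
qed

text \<open>A union bound given that \<open>A\<close> is a clique. Only bicliques with two vertices
  in \<open>A\<close> can cause an edge of \<open>A\<close> to be deleted. In \<open>sparse\<close>,
  the squared exponential pays for the sums over \<open>U\<close> and \<open>V\<close>, and the
  factor 4 leaves failure probability at most 1/4.\<close>

lemma card_biclique_conflicts_le:
  assumes m: "0 < m" and n: "0 < n" and A: "A \<subseteq> {..<n}"
    and sparse: "\<And>j. 2 \<le> j \<Longrightarrow> j \<le> card A \<Longrightarrow>
      4 * exp (1 + real (card A)) ^ 2 * real n ^ (s + t) \<le> real m ^ (s * t - (j choose 2)) * real n ^ j"
  shows "4 * real (card {f \<in> colourings_zero_on n m (pairs A). \<exists>U V. U \<subseteq> {..<n} \<and> V \<subseteq> {..<n} \<and>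
      U \<inter> V = {} \<and> card U = s \<and> card V = t \<and> 2 \<le> card (A \<inter> (U \<union> V)) \<and> (\<forall>e\<in>cross U V. f e = 0)})
    \<le> card (colourings_zero_on n m (pairs A))"
    (is "4 * real (card ?F) \<le> real ?N")
proof -
  let ?X = "{..<n}"
  let ?K = "exp (1 + real (card A))"
  have finA: "finite A" using A finite_subset by blast
  define I where "I = {(U, V). U \<subseteq> ?X \<and> V \<subseteq> ?X \<and> U \<inter> V = {} \<and> card U = s \<and> card V = t \<and>
    2 \<le> card (A \<inter> (U \<union> V))}"
  have I_sub: "I \<subseteq> Pow ?X \<times> Pow ?X" unfolding I_def by auto
  then have finI: "finite I" by (rule finite_subset) auto
  have "?F \<subseteq> (\<Union>(U, V)\<in>I. colourings_zero_on n m (pairs A \<union> cross U V))"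
  proof clarify
    fix f U V assume "f \<in> colourings_zero_on n m (pairs A)" "\<forall>e\<in>cross U V. f e = 0"
      "U \<subseteq> ?X" "V \<subseteq> ?X" "U \<inter> V = {}" "s = card U" "t = card V" "2 \<le> card (A \<inter> (U \<union> V))"
    then show "f \<in> (\<Union>(U, V)\<in>I. colourings_zero_on n m (pairs A \<union> cross U V))"
      by (intro UN_I[of "(U, V)"]) (auto simp: I_def colourings_zero_on_def)
  qed
  then have "card ?F \<le> card (\<Union>(U, V)\<in>I. colourings_zero_on n m (pairs A \<union> cross U V))"
    using finI by (intro card_mono) (auto intro!: finite_colourings)
  also have "\<dots> \<le> (\<Sum>(U, V)\<in>I. card (colourings_zero_on n m (pairs A \<union> cross U V)))"
    using card_UN_le[OF finI, of "\<lambda>(U, V). colourings_zero_on n m (pairs A \<union> cross U V)"]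
    by (simp add: case_prod_unfold)
  finally have "real (card ?F) \<le> (\<Sum>(U, V)\<in>I. real (card (colourings_zero_on n m (pairs A \<union> cross U V))))"
    by (simp add: case_prod_unfold flip: of_nat_sum)
  also have "\<dots> \<le> (\<Sum>(U, V)\<in>I. ?N / (4 * ?K ^ 2) * (weight n A U * weight n A V))"
  proof (rule sum_mono, clarify)
    fix U V assume "(U, V) \<in> I"
    then have UV: "U \<subseteq> ?X" "V \<subseteq> ?X" "U \<inter> V = {}" "card U = s" "card V = t"
      and j2: "2 \<le> card (A \<inter> (U \<union> V))" by (auto simp: I_def)
    define j where "j = card (A \<inter> (U \<union> V))"
    have fin: "finite U" "finite V" using UV finite_subset by blast+
    have jA: "j \<le> card A" unfolding j_def using finA by (intro card_mono) auto
    \<comment> \<open>Pairs already known to be edges lie within the \<open>j\<close> common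
      vertices, so the biclique forces at least \<open>s * t - (j choose 2)\<close> new
      ones.\<close>
    have "card (pairs A \<inter> cross U V) \<le> card (pairs (A \<inter> (U \<union> V)))"
      using cross_subset_pairs[OF UV(3)] finA
      by (intro card_mono) (auto simp: finite_pairs simp flip: pairs_Int)
    then have "card (pairs A \<inter> cross U V) \<le> j choose 2"
      using finA by (simp add: card_pairs j_def)
    then have "s * t - (j choose 2) \<le> card (cross U V - pairs A)"
      using card_cross[OF UV(3)] UV(4,5) card_Diff_subset_Int[of "cross U V" "pairs A"] fin
      by (simp add: Int_commute finite_pairs finA)
    moreover have "pairs A \<subseteq> pairs ?X" "cross U V \<subseteq> pairs ?X"
      using A UV cross_subset_pairs[OF UV(3)] pairs_mono[of "U \<union> V" ?X] pairs_mono[of A ?X] by auto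
    ultimately have "real (card (colourings_zero_on n m (pairs A \<union> cross U V)))
        \<le> ?N / real m ^ (s * t - (j choose 2))"
      using m by (intro card_colourings_zero_on_Un)
    also have "\<dots> \<le> ?N / (4 * ?K ^ 2) * (real n ^ j / real n ^ (s + t))"
    proof -
      have "1 / real m ^ (s * t - (j choose 2)) \<le> 1 / (4 * ?K ^ 2) * (real n ^ j / real n ^ (s + t))"
        using sparse[of j] j2 jA m n unfolding j_def[symmetric] by (simp add: field_simps)
      then have "?N * (1 / real m ^ (s * t - (j choose 2))) \<le> ?N * (1 / (4 * ?K ^ 2) * (real n ^ j / real n ^ (s + t)))"
        by (rule mult_left_mono) simp
      then show ?thesis by simp
    qed
    also have "real n ^ j / real n ^ (s + t) = weight n A U * weight n A V"
    proof -
      have "weight n A U * weight n A V = weight n A (U \<union> V)"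
        unfolding weight_def using fin UV(3) by (simp add: prod.union_disjoint)
      then show ?thesis
        using weight_eq[of "U \<union> V" n A] fin n UV(3-5) by (simp add: j_def card_Un_disjoint)
    qed
    finally show "real (card (colourings_zero_on n m (pairs A \<union> cross U V)))
        \<le> ?N / (4 * ?K ^ 2) * (weight n A U * weight n A V)" by simp
  qed
  also have "\<dots> = ?N / (4 * ?K ^ 2) * (\<Sum>(U, V)\<in>I. weight n A U * weight n A V)"
    by (simp add: sum_distrib_left case_prod_unfold)
  finally have F_le: "real (card ?F)
      \<le> ?N / (4 * ?K ^ 2) * (\<Sum>(U, V)\<in>I. weight n A U * weight n A V)" .
  \<comment> \<open>Dropping the constraints on \<open>U\<close> and \<open>V\<close> lets the
    double sum factor into a square.\<close>
  have "(\<Sum>(U, V)\<in>I. weight n A U * weight n A V)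
      \<le> (\<Sum>(U, V)\<in>Pow ?X \<times> Pow ?X. weight n A U * weight n A V)"
    using I_sub by (intro sum_mono2) (auto intro!: weight_nonneg mult_nonneg_nonneg)
  also have "\<dots> = (\<Sum>U\<in>Pow ?X. weight n A U) ^ 2"
    by (simp add: power2_eq_square sum_product sum.cartesian_product)
  also have "\<dots> \<le> ?K ^ 2"
    using sum_weight_le[OF finA n] by (intro power_mono sum_nonneg weight_nonneg)
  finally have "(\<Sum>(U, V)\<in>I. weight n A U * weight n A V) \<le> ?K ^ 2" .
  then have "?N / (4 * ?K ^ 2) * (\<Sum>(U, V)\<in>I. weight n A U * weight n A V)
      \<le> ?N / (4 * ?K ^ 2) * ?K ^ 2"
    by (rule mult_left_mono) auto
  also have "\<dots> = ?N / 4" by simp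
  finally have "real (card ?F) \<le> ?N / 4" using F_le by (rule order.trans[rotated])
  then show ?thesis by linarith
qed

text \<open>Markov's inequality given that \<open>A\<close> is a clique; \<open>L\<close> is four
  times the bound on the conditional mean. A set \<open>B\<close> sharing \<open>j\<close> vertices
  with \<open>A\<close> gains a factor \<open>m ^ (j choose 2)\<close>, and \<open>dense\<close>
  lets the weight absorb it.\<close>

lemma card_many_cliques_le:
  assumes m: "0 < m" and n: "0 < n" and A: "A \<subseteq> {..<n}"
    and dense: "\<And>j. j \<le> u \<Longrightarrow> m ^ (j choose 2) \<le> n ^ j"
  defines "L \<equiv> 4 * exp (1 + real (card A)) * real n ^ u / real m ^ (u choose 2)"
  shows "4 * real (card {f \<in> colourings_zero_on n m (pairs A).
      L < card {B. B \<subseteq> {..<n} \<and> card B = u \<and> (\<forall>e\<in>pairs B. f e = 0)}})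
    \<le> card (colourings_zero_on n m (pairs A))"
    (is "4 * real (card ?F) \<le> real (card ?N)")
proof -
  let ?X = "{..<n}"
  let ?K = "exp (1 + real (card A))"
  have finA: "finite A" using A finite_subset by blast
  define I where "I = {B. B \<subseteq> ?X \<and> card B = u}"
  define c where "c f = card {B \<in> I. \<forall>e\<in>pairs B. f e = 0}" for f :: "nat set \<Rightarrow> nat"
  have finI: "finite I" unfolding I_def by simp
  have Lpos: "0 < L" unfolding L_def using m n by simp
  have F: "?F = {f \<in> ?N. L < c f}" unfolding c_def I_def by (simp add: conj_assoc)
  \<comment> \<open>Markov's inequality, followed by counting pairs of a colouring and a
    \<open>u\<close>-clique in the other order.\<close>
  have "L * card ?F = (\<Sum>f\<in>?F. L)" by simp
  also have "\<dots> \<le> (\<Sum>f\<in>?F. real (c f))" unfolding F by (intro sum_mono) auto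
  also have "\<dots> \<le> (\<Sum>f\<in>?N. real (c f))"
    unfolding F by (intro sum_mono2) (auto intro: finite_colourings)
  also have "\<dots> = (\<Sum>f\<in>?N. \<Sum>B\<in>I. if \<forall>e\<in>pairs B. f e = 0 then 1 else 0)"
    unfolding c_def using finI by (simp add: sum.If_cases Int_def)
  also have "\<dots> = (\<Sum>B\<in>I. \<Sum>f\<in>?N. if \<forall>e\<in>pairs B. f e = 0 then 1 else 0)"
    by (rule sum.swap)
  also have "\<dots> = (\<Sum>B\<in>I. real (card (colourings_zero_on n m (pairs A \<union> pairs B))))"
  proof (rule sum.cong[OF refl])
    fix B
    have "colourings_zero_on n m (pairs A \<union> pairs B) = ?N \<inter> {f. \<forall>e\<in>pairs B. f e = 0}"
      unfolding colourings_zero_on_def by auto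
    then show "(\<Sum>f\<in>?N. if \<forall>e\<in>pairs B. f e = 0 then 1 else 0)
        = real (card (colourings_zero_on n m (pairs A \<union> pairs B)))"
      by (simp add: sum.If_cases finite_colourings)
  qed
  also have "\<dots> \<le> (\<Sum>B\<in>I. card ?N * (real n ^ u / real m ^ (u choose 2)) * weight n A B)"
  proof (rule sum_mono)
    fix B assume "B \<in> I"
    then have B: "B \<subseteq> ?X" "card B = u" by (auto simp: I_def)
    then have finB: "finite B" using finite_subset by blast
    define j where "j = card (A \<inter> B)"
    have ju: "j \<le> u" unfolding j_def B(2)[symmetric] using finB by (intro card_mono) auto
    have "card (pairs A \<inter> pairs B) = j choose 2"
      using finA by (simp add: pairs_Int card_pairs j_def)
    then have "(u choose 2) - (j choose 2) \<le> card (pairs B - pairs A)"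
      using card_Diff_subset_Int[of "pairs B" "pairs A"] finB B(2)
      by (simp add: Int_commute finite_pairs card_pairs finA)
    then have "real (card (colourings_zero_on n m (pairs A \<union> pairs B)))
        \<le> card ?N / real m ^ ((u choose 2) - (j choose 2))"
      using m A B by (intro card_colourings_zero_on_Un pairs_mono)
    also have "real m ^ ((u choose 2) - (j choose 2)) = real m ^ (u choose 2) / real m ^ (j choose 2)"
      using m ju by (simp add: power_diff binomial_right_mono)
    also have "card ?N / (real m ^ (u choose 2) / real m ^ (j choose 2)) \<le> card ?N / (real m ^ (u choose 2)) * real n ^ j"
    proof -
      have "real m ^ (j choose 2) \<le> real n ^ j"
        using dense[OF ju] by (metis of_nat_le_iff of_nat_power)
      then have "card ?N / (real m ^ (u choose 2)) * real m ^ (j choose 2)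
          \<le> card ?N / (real m ^ (u choose 2)) * real n ^ j"
        by (intro mult_left_mono) auto
      then show ?thesis by simp
    qed
    also have "\<dots> = card ?N * (real n ^ u / real m ^ (u choose 2)) * weight n A B"
      using weight_eq[OF finB n] n by (simp add: j_def B(2))
    finally show "real (card (colourings_zero_on n m (pairs A \<union> pairs B)))
        \<le> card ?N * (real n ^ u / real m ^ (u choose 2)) * weight n A B" .
  qed
  also have "\<dots> = card ?N * (real n ^ u / real m ^ (u choose 2)) * (\<Sum>B\<in>I. weight n A B)"
    by (simp add: sum_distrib_left)
  also have "\<dots> \<le> card ?N * (real n ^ u / real m ^ (u choose 2)) * ?K"
  proof (rule mult_left_mono)
    have "(\<Sum>B\<in>I. weight n A B) \<le> (\<Sum>B\<in>Pow ?X. weight n A B)"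
      unfolding I_def by (intro sum_mono2) (auto intro: weight_nonneg)
    then show "(\<Sum>B\<in>I. weight n A B) \<le> ?K" using sum_weight_le[OF finA n] by simp
  qed auto
  also have "\<dots> = L * (card ?N / 4)" unfolding L_def by simp
  finally have "real (card ?F) \<le> card ?N / 4" using Lpos by simp
  then show ?thesis by simp
qed

section \<open>Averaging and deletion\<close>

text \<open>Among the colourings making \<open>A\<close> a clique, each of the two failures takes at
  most a quarter, so half are good for \<open>A\<close>. Averaging over all colourings yields one
  with at least \<open>v\<close> good \<open>r\<close>-sets; these survive the deletion.\<close>

lemma exists_sparse_graph:
  assumes m: "0 < m" and n: "0 < n" "r \<le> n" and st: "1 \<le> s" "1 \<le> t"
    and sparse: "\<And>j. 2 \<le> j \<Longrightarrow> j \<le> r \<Longrightarrow>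
      4 * exp (1 + real r) ^ 2 * real n ^ (s + t) \<le> real m ^ (s * t - (j choose 2)) * real n ^ j"
    and dense: "\<And>j. j \<le> u \<Longrightarrow> m ^ (j choose 2) \<le> n ^ j"
  shows "\<exists>G :: nat pair_pre_digraph. pair_graph G \<and> \<not> has_biclique s t G \<and>
      real (card (cliques u G)) \<le> 4 * exp (1 + real r) * real n ^ u / real m ^ (u choose 2) \<and>
      real (n choose r) / (2 * real m ^ (r choose 2)) \<le> real (card (cliques r G))"
proof -
  let ?X = "{..<n}"
  define L where "L = 4 * exp (1 + real r) * real n ^ u / real m ^ (u choose 2)"
  define v where "v = real (n choose r) / (2 * real m ^ (r choose 2))"
  define bi where "bi f U V \<longleftrightarrow> U \<subseteq> ?X \<and> V \<subseteq> ?X \<and> U \<inter> V = {} \<and> card U = s \<and> card V = t \<and>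
    (\<forall>e\<in>cross U V. f e = 0)" for f :: "nat set \<Rightarrow> nat" and U V
  define c where "c f = card {B. B \<subseteq> ?X \<and> card B = u \<and> (\<forall>e\<in>pairs B. f e = 0)}"
    for f :: "nat set \<Rightarrow> nat"
  define N where "N A = colourings_zero_on n m (pairs A)" for A
  define bad1 where "bad1 A = {f \<in> N A. \<exists>U V. bi f U V \<and> 2 \<le> card (A \<inter> (U \<union> V))}" for A
  define bad2 where "bad2 A = {f \<in> N A. L < c f}" for A
  define good where "good A = N A - (bad1 A \<union> bad2 A)" for A
  define I where "I = {A. A \<subseteq> ?X \<and> card A = r}"
  define \<Omega> where "\<Omega> = colourings_zero_on n m {}"
  have finN: "finite (N A)" for A unfolding N_def by (rule finite_colourings)
  have fin\<Omega>: "finite \<Omega>" unfolding \<Omega>_def by (rule finite_colourings)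
  have finI: "finite I" unfolding I_def by simp
  have card\<Omega>: "card \<Omega> = m ^ (n choose 2)"
    using card_colourings_zero_on[OF m, of "{}" n] by (simp add: \<Omega>_def)
  have cardI: "card I = n choose r" unfolding I_def by (simp add: n_subsets)
  have good_ge: "real (card \<Omega>) / (2 * real m ^ (r choose 2)) \<le> real (card (good A))" if "A \<in> I" for A
  proof -
    have A: "A \<subseteq> ?X" "card A = r" using that by (auto simp: I_def)
    then have finA: "finite A" using finite_subset by blast
    have b1: "4 * real (card (bad1 A)) \<le> card (N A)"
    proof -
      have "bad1 A = {f \<in> N A. \<exists>U V. U \<subseteq> ?X \<and> V \<subseteq> ?X \<and> U \<inter> V = {} \<and> card U = s \<and>
          card V = t \<and> 2 \<le> card (A \<inter> (U \<union> V)) \<and> (\<forall>e\<in>cross U V. f e = 0)}"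
        unfolding bad1_def bi_def by (simp add: conj_ac)
      then show ?thesis
        unfolding N_def using card_biclique_conflicts_le[OF m n(1) A(1), of s t] sparse A(2) by simp
    qed
    have b2: "4 * real (card (bad2 A)) \<le> card (N A)"
      unfolding bad2_def c_def N_def L_def
      using card_many_cliques_le[OF m n(1) A(1) dense] by (simp add: A(2))
    have "card (N A) \<le> card (good A) + card (bad1 A \<union> bad2 A)"
      unfolding good_def using diff_card_le_card_Diff[of "bad1 A \<union> bad2 A" "N A"] finN
      by (simp add: bad1_def bad2_def)
    also have "card (bad1 A \<union> bad2 A) \<le> card (bad1 A) + card (bad2 A)" by (rule card_Un_le)
    finally have "real (card (N A)) \<le> 2 * real (card (good A))" using b1 b2 by linarith
    moreover have "card (N A) * m ^ (r choose 2) = card \<Omega>"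
      using card_colourings_zero_on[OF m, of "pairs A" n] pairs_mono[OF A(1)] card\<Omega>
      by (simp add: N_def card_pairs[OF finA] A(2))
    then have "real (card \<Omega>) = real (card (N A)) * real m ^ (r choose 2)"
      by (metis of_nat_mult of_nat_power)
    ultimately show ?thesis using m by (simp add: field_simps)
  qed
  have "real (card \<Omega>) * v = (\<Sum>A\<in>I. real (card \<Omega>) / (2 * real m ^ (r choose 2)))"
    by (simp add: cardI v_def)
  also have "\<dots> \<le> (\<Sum>A\<in>I. real (card (good A)))" by (intro sum_mono good_ge)
  also have "\<dots> = (\<Sum>A\<in>I. \<Sum>f\<in>\<Omega>. if f \<in> good A then 1 else 0)"
  proof (rule sum.cong[OF refl])
    fix A
    have "good A \<subseteq> \<Omega>" unfolding good_def N_def \<Omega>_def colourings_zero_on_def by auto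
    then have "\<Omega> \<inter> {f. f \<in> good A} = good A" by auto
    then show "real (card (good A)) = (\<Sum>f\<in>\<Omega>. if f \<in> good A then 1 else 0)"
      using fin\<Omega> by (simp add: sum.If_cases)
  qed
  also have "\<dots> = (\<Sum>f\<in>\<Omega>. \<Sum>A\<in>I. if f \<in> good A then 1 else 0)" by (rule sum.swap)
  also have "\<dots> = (\<Sum>f\<in>\<Omega>. real (card {A \<in> I. f \<in> good A}))"
    using finI by (simp add: sum.If_cases Int_def)
  finally have avg: "real (card \<Omega>) * v \<le> (\<Sum>f\<in>\<Omega>. real (card {A \<in> I. f \<in> good A}))" .
  have "0 < card \<Omega>" using card\<Omega> m by simp
  then have "\<Omega> \<noteq> {}" by auto
  obtain f where f: "f \<in> \<Omega>" "v \<le> real (card {A \<in> I. f \<in> good A})"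
  proof (rule ccontr)
    assume "\<not> thesis"
    then have "\<And>f. f \<in> \<Omega> \<Longrightarrow> real (card {A \<in> I. f \<in> good A}) < v"
      using that not_less by blast
    then have "(\<Sum>f\<in>\<Omega>. real (card {A \<in> I. f \<in> good A})) < (\<Sum>f\<in>\<Omega>. v)"
      using fin\<Omega> \<open>\<Omega> \<noteq> {}\<close> by (intro sum_strict_mono)
    then show False using avg by simp
  qed
  \<comment> \<open>A single good set suffices to bound \<open>c f\<close>, since the condition
    \<open>L < c f\<close> in \<open>bad2\<close> does not depend on \<open>A\<close>.\<close>
  have "0 < v" unfolding v_def using m n by (simp add: zero_less_binomial_iff)
  then have "0 < card {A \<in> I. f \<in> good A}" using f(2) by linarith
  then have "{A \<in> I. f \<in> good A} \<noteq> {}" by (metis card.empty less_irrefl)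
  then have cf: "real (c f) \<le> L" by (auto simp: good_def bad2_def)

  \<comment> \<open>Every edge of every biclique is removed at once. A biclique left over would be
    one of \<open>f\<close> as well, and its edges, of which there is at least one, would be
    gone.\<close>
  define E where "E = {e \<in> pairs ?X. f e = 0 \<and> \<not> (\<exists>U V. bi f U V \<and> e \<in> cross U V)}"
  define G where "G = \<lparr>pverts = ?X, parcs = {(x, y). {x, y} \<in> E}\<rparr>"
  have "pair_graph G"
    by (rule pair_graphI) (auto simp: G_def E_def pairs_def insert_commute)
  moreover have "\<not> has_biclique s t G"
  proof
    assume "has_biclique s t G"
    then obtain U V where UV: "U \<subseteq> ?X" "V \<subseteq> ?X" "U \<inter> V = {}"
      "card U = s" "card V = t" "U \<times> V \<subseteq> {(x, y). {x, y} \<in> E}"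
      unfolding has_biclique_def G_def by auto
    have E: "cross U V \<subseteq> E" using UV(6) by (auto simp: cross_def)
    then have "bi f U V" using UV by (auto simp: bi_def E_def)
    moreover have "U \<noteq> {}" "V \<noteq> {}" using UV(4,5) st by auto
    then have "cross U V \<noteq> {}" by (simp add: cross_def)
    ultimately show False using E by (auto simp: E_def)
  qed
  moreover have "real (card (cliques u G)) \<le> L"
  proof -
    have "cliques u G \<subseteq> {B. B \<subseteq> ?X \<and> card B = u \<and> (\<forall>e\<in>pairs B. f e = 0)}"
      by (auto simp: cliques_def G_def E_def pairs_def card_2_iff)
    then have "card (cliques u G) \<le> c f" unfolding c_def by (intro card_mono) auto
    then show ?thesis using cf by linarith
  qed
  moreover have "v \<le> real (card (cliques r G))"
  proof -
    have "{A \<in> I. f \<in> good A} \<subseteq> cliques r G"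
    proof clarify
      fix A assume A: "A \<in> I" "f \<in> good A"
      then have sub: "A \<subseteq> ?X" "card A = r" by (auto simp: I_def)
      have "{x, y} \<in> E" if xy: "x \<in> A" "y \<in> A" "x \<noteq> y" for x y
      proof -
        have "{x, y} \<in> pairs A" using xy by (auto simp: pairs_def)
        then have "f {x, y} = 0" "{x, y} \<in> pairs ?X"
          using A(2) pairs_mono[OF sub(1)] by (auto simp: good_def N_def colourings_zero_on_def)
        \<comment> \<open>A deleted edge of \<open>A\<close> would have both ends in
          \<open>A\<close> and in a biclique, which \<open>bad1\<close> rules out.\<close>
        moreover have False if UV: "bi f U V" "{x, y} \<in> cross U V" for U V
        proof -
          have "{x, y} \<subseteq> A \<inter> (U \<union> V)"
            using UV xy cross_subset_pairs[of U V] by (auto simp: bi_def pairs_def)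
          moreover have "finite (A \<inter> (U \<union> V))" using sub(1) finite_subset by blast
          ultimately have "card {x, y} \<le> card (A \<inter> (U \<union> V))" by (intro card_mono)
          then have "2 \<le> card (A \<inter> (U \<union> V))" using xy(3) by (simp add: numeral_2_eq_2)
          then have "f \<in> bad1 A" using UV A(2) by (auto simp: bad1_def good_def)
          then show False using A(2) by (simp add: good_def)
        qed
        ultimately show ?thesis unfolding E_def by blast
      qed
      then show "A \<in> cliques r G" using sub by (auto simp: cliques_def G_def)
    qed
    then have "card {A \<in> I. f \<in> good A} \<le> card (cliques r G)"
      by (intro card_mono finite_cliques) (auto simp: G_def)
    then show ?thesis using f(2) by linarith
  qed
  ultimately show ?thesis unfolding L_def v_def by blast
qed

section \<open>Choice of parameters\<close>

lemma real_choose_two: "real (n choose 2) = real n * (real n - 1) / 2"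
  by (induction n) (auto simp: numeral_2_eq_2 field_simps)

text \<open>A strict gap between exponents absorbs any constants.\<close>

lemma eventually_mult_powr_le:
  fixes c d :: real
  assumes "a < b" "0 < d"
  shows "\<forall>\<^sub>F n in sequentially. c * real n powr a \<le> d * real n powr b"
proof -
  have "filterlim (\<lambda>n. real n powr (b - a)) at_top sequentially"
    using assms(1) by (intro filterlim_compose[OF real_powr_at_top filterlim_real_sequentially]) simp
  then have "\<forall>\<^sub>F n in sequentially. c / d \<le> real n powr (b - a)"
    by (simp add: filterlim_at_top)
  then show ?thesis
  proof eventually_elim
    case (elim n)
    then have "c \<le> d * real n powr (b - a)" using assms(2) by (simp add: field_simps)
    then have "c * real n powr a \<le> d * real n powr (b - a) * real n powr a"
      by (intro mult_right_mono) auto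
    then show ?case by (simp add: mult.assoc flip: powr_add)
  qed
qed

lemma half_le_floor:
  fixes x :: real
  assumes "1 \<le> x"
  shows "x / 2 \<le> real (nat \<lfloor>x\<rfloor>)"
proof -
  have "1 \<le> real_of_int \<lfloor>x\<rfloor>" using assms by simp
  then show ?thesis using assms real_of_int_floor_add_one_gt[of x] by linarith
qed

text \<open>Here \<open>n\<close> is \<open>m powr \<alpha>\<close> rounded down. Strictness in
  \<open>sparse\<close> absorbs the constant of the union bound for large \<open>m\<close>, and
  \<open>\<alpha>\<close> being at least \<open>r - 1\<close> provides the density
  condition.\<close>

lemma eventually_sparse_graph:
  fixes \<alpha> :: real
  assumes u: "2 \<le> u" "u < r" and s: "r choose 2 \<le> s" "r \<le> s" "s \<le> t"
    and \<alpha>: "real r - 1 \<le> \<alpha>"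
    and sparse: "\<And>j. 2 \<le> j \<Longrightarrow> j \<le> r \<Longrightarrow>
      \<alpha> * (real s + real t - real j) < real s * real t - real (j choose 2)"
  shows "\<forall>\<^sub>F m in sequentially. \<exists>G :: nat pair_pre_digraph. pair_graph G \<and> \<not> has_biclique s t G \<and>
      real (card (cliques u G)) \<le> 4 * exp (1 + real r) * real m powr (real u * \<alpha> - real (u choose 2)) \<and>
      1 / (2 * (2 * real r) ^ r) * real m powr (real r * \<alpha> - real (r choose 2)) \<le> real (card (cliques r G))"
proof -
  let ?K = "4 * exp (1 + real r) ^ 2"
  have "\<forall>\<^sub>F m in sequentially. \<forall>j\<in>{2..r}. ?K * real m powr (\<alpha> * (real s + real t - real j))
      \<le> 1 * real m powr (real s * real t - real (j choose 2))"
    using sparse by (intro eventually_ball_finite ballI eventually_mult_powr_le) auto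
  moreover have "\<forall>\<^sub>F m in sequentially. r \<le> m" by (rule eventually_ge_at_top)
  ultimately show ?thesis
  proof eventually_elim
    case (elim m)
    have m: "1 \<le> m" "0 < m" using elim(2) u by auto
    have "0 < \<alpha>" using \<alpha> u by simp
    define x where "x = real m powr \<alpha>"
    define n where "n = nat \<lfloor>x\<rfloor>"
    have "real m powr real (r - 1) \<le> x"
      unfolding x_def using \<alpha> m u by (intro powr_mono) auto
    then have "real (m ^ (r - 1)) \<le> x" using m by (simp add: powr_realpow)
    \<comment> \<open>Rounding down does not lose this bound because \<open>m ^ (r - 1)\<close> is
      an integer. It gives both \<open>r \<le> n\<close> and the density condition.\<close>
    then have n_ge: "m ^ (r - 1) \<le> n" unfolding n_def by (simp add: le_nat_floor)
    have "m \<le> m ^ (r - 1)" using m(1) u by (intro self_le_power) auto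
    then have nm: "r \<le> n" "0 < n" using n_ge elim(2) m by auto
    have x1: "1 \<le> x" unfolding x_def using m \<open>0 < \<alpha>\<close> by (simp add: ge_one_powr_ge_zero)
    have n_le: "real n \<le> x" unfolding n_def using x1 by simp
    have x_le: "x / 2 \<le> real n" unfolding n_def using x1 by (rule half_le_floor)
    have x_pow: "x ^ k = real m powr (real k * \<alpha>)" for k
      unfolding x_def using m by (simp add: powr_powr powr_power mult.commute flip: powr_realpow)
    have m_pow: "real m ^ k = real m powr real k" for k using m by (simp add: powr_realpow)
    have st: "1 \<le> s" "1 \<le> t" using s u by auto
    have "\<exists>G :: nat pair_pre_digraph. pair_graph G \<and> \<not> has_biclique s t G \<and>
      real (card (cliques u G)) \<le> 4 * exp (1 + real r) * real n ^ u / real m ^ (u choose 2) \<and>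
      real (n choose r) / (2 * real m ^ (r choose 2)) \<le> real (card (cliques r G))"
    proof (rule exists_sparse_graph[OF m(2) nm(2,1) st])
      fix j :: nat assume j: "2 \<le> j" "j \<le> r"
      have jst: "j \<le> s + t" using j(2) s by linarith
      have "j choose 2 \<le> s" using binomial_right_mono[OF j(2), of 2] s(1) by linarith
      also have "s \<le> s * t" using st by simp
      finally have j2: "j choose 2 \<le> s * t" .
      have "?K * real n ^ (s + t - j) \<le> ?K * x ^ (s + t - j)"
        using n_le by (intro mult_left_mono power_mono) auto
      also have "\<dots> = ?K * real m powr (\<alpha> * (real s + real t - real j))"
        unfolding x_pow using jst by (simp add: of_nat_diff mult.commute)
      also have "\<dots> \<le> real m powr (real s * real t - real (j choose 2))" using elim(1) j by simp
      also have "\<dots> = real m ^ (s * t - (j choose 2))"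
        unfolding m_pow using j2 by (simp add: of_nat_diff)
      finally have "?K * real n ^ (s + t - j) * real n ^ j
          \<le> real m ^ (s * t - (j choose 2)) * real n ^ j"
        by (rule mult_right_mono) simp
      moreover have "real n ^ (s + t - j) * real n ^ j = real n ^ (s + t)"
        using jst by (simp flip: power_add)
      ultimately show "?K * real n ^ (s + t) \<le> real m ^ (s * t - (j choose 2)) * real n ^ j"
        by (simp add: mult.assoc)
    next
      fix j :: nat assume "j \<le> u"
      have "j choose 2 \<le> j * (j - 1)" by (simp add: choose_two)
      also have "\<dots> \<le> j * (r - 1)" using \<open>j \<le> u\<close> u by (intro mult_le_mono2) auto
      finally have "j choose 2 \<le> (r - 1) * j" by (simp add: mult.commute)
      then have "m ^ (j choose 2) \<le> m ^ ((r - 1) * j)" using m by (intro power_increasing) auto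
      also have "\<dots> \<le> n ^ j" using n_ge by (simp add: power_mult power_mono)
      finally show "m ^ (j choose 2) \<le> n ^ j" .
    qed
    then obtain G :: "nat pair_pre_digraph" where G: "pair_graph G" "\<not> has_biclique s t G"
      and Gu: "real (card (cliques u G)) \<le> 4 * exp (1 + real r) * real n ^ u / real m ^ (u choose 2)"
      and Gr: "real (n choose r) / (2 * real m ^ (r choose 2)) \<le> real (card (cliques r G))"
      by blast
    note Gu
    also have "4 * exp (1 + real r) * real n ^ u / real m ^ (u choose 2)
        \<le> 4 * exp (1 + real r) * x ^ u / real m ^ (u choose 2)"
      using n_le by (intro divide_right_mono mult_left_mono power_mono) auto
    also have "\<dots> = 4 * exp (1 + real r) * real m powr (real u * \<alpha> - real (u choose 2))"
      unfolding x_pow m_pow by (simp add: powr_diff)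
    finally have 1: "real (card (cliques u G))
        \<le> 4 * exp (1 + real r) * real m powr (real u * \<alpha> - real (u choose 2))" .
    \<comment> \<open>In the constant, the outer 2 comes from the good half of the colourings, the
      inner 2 from rounding, and \<open>r\<close> from \<open>n choose r\<close> being at least
      \<open>(n / r) ^ r\<close>.\<close>
    have "1 / (2 * (2 * real r) ^ r) * real m powr (real r * \<alpha> - real (r choose 2))
        = (x / 2 / real r) ^ r / (2 * real m ^ (r choose 2))"
      by (simp add: m_pow powr_diff power_divide power_mult_distrib flip: x_pow)
    also have "\<dots> \<le> (real n / real r) ^ r / (2 * real m ^ (r choose 2))"
      using x_le x1 by (intro divide_right_mono power_mono) auto
    also have "\<dots> \<le> real (n choose r) / (2 * real m ^ (r choose 2))"
      using binomial_ge_n_over_k_pow_k[OF nm(1), where 'a = real]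
      by (intro divide_right_mono) auto
    also note Gr
    finally show ?case using G 1 by blast
  qed
qed

text \<open>The value \<open>\<alpha>\<^sub>0\<close> equates the largest left side, at
  \<open>j = 2\<close>, with the smallest right side, at \<open>j = r\<close>. As
  \<open>r > 2\<close>, no single \<open>j\<close> attains both extremes, so all the inequalities
  are strict and survive a small increase of the exponent.\<close>

lemma exists_exponent:
  fixes r s t :: nat
  assumes r: "3 \<le> r" and s: "r choose 2 \<le> s" "2 * r - 2 \<le> s" "s \<le> t"
  defines "\<alpha>\<^sub>0 \<equiv> (real s * real t - real (r choose 2)) / (real s + real t - 2)"
  shows "real r - 1 \<le> \<alpha>\<^sub>0"
    and "\<exists>\<alpha>>\<alpha>\<^sub>0. \<forall>j. 2 \<le> j \<longrightarrow> j \<le> r \<longrightarrow>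
      \<alpha> * (real s + real t - real j) < real s * real t - real (j choose 2)"
proof -
  have s': "2 * (real r - 1) \<le> real s" "real (r choose 2) \<le> real s" "real s \<le> real t" "4 \<le> real s"
    using r s by auto
  have pos: "0 < real s + real t - 2" using s' by linarith
  \<comment> \<open>Both lower bounds on \<open>s\<close> enter: \<open>2 * r - 2\<close> gives the
    factor \<open>s\<close>, and \<open>r choose 2\<close> turns \<open>s * (t - 1)\<close> into the
    numerator.\<close>
  have "(real r - 1) * (real s + real t - 2) \<le> (real r - 1) * (2 * (real t - 1))"
    using s' r by (intro mult_left_mono) auto
  also have "\<dots> = 2 * (real r - 1) * (real t - 1)" by (simp add: algebra_simps)
  also have "\<dots> \<le> real s * (real t - 1)" using s' by (intro mult_right_mono) auto
  also have "\<dots> \<le> real s * real t - real (r choose 2)" using s' by (simp add: algebra_simps)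
  finally show ge: "real r - 1 \<le> \<alpha>\<^sub>0" unfolding \<alpha>\<^sub>0_def using pos by (simp add: le_divide_eq)
  have mul: "\<alpha>\<^sub>0 * (real s + real t - 2) = real s * real t - real (r choose 2)"
    unfolding \<alpha>\<^sub>0_def using pos by simp
  have \<alpha>0: "0 < \<alpha>\<^sub>0" using ge r by simp
  have strict: "\<alpha>\<^sub>0 * (real s + real t - real j) < real s * real t - real (j choose 2)"
    if j: "2 \<le> j" "j \<le> r" for j
  proof (cases "j = r")
    case True
    have "\<alpha>\<^sub>0 * (real s + real t - real j) < \<alpha>\<^sub>0 * (real s + real t - 2)"
      using True r \<alpha>0 by simp
    then show ?thesis using mul True by simp
  next
    case False
    have "\<alpha>\<^sub>0 * (real s + real t - real j) \<le> \<alpha>\<^sub>0 * (real s + real t - 2)"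
      using j \<alpha>0 by simp
    moreover have "real (j choose 2) < real (r choose 2)"
    proof -
      have "real j * (real j - 1) < real r * (real r - 1)"
        using False j by (intro mult_strict_mono) auto
      then show ?thesis by (simp add: real_choose_two)
    qed
    ultimately show ?thesis using mul by linarith
  qed
  have "\<forall>\<^sub>F \<alpha> in at_right \<alpha>\<^sub>0. \<forall>j\<in>{2..r}.
      \<alpha> * (real s + real t - real j) < real s * real t - real (j choose 2)"
  proof (intro eventually_ball_finite ballI)
    fix j assume "j \<in> {2..r}"
    then have "\<alpha>\<^sub>0 * (real s + real t - real j) < real s * real t - real (j choose 2)"
      using strict by simp
    moreover have "((\<lambda>\<alpha>. \<alpha> * (real s + real t - real j)) \<longlongrightarrow> \<alpha>\<^sub>0 * (real s + real t - real j))
        (at_right \<alpha>\<^sub>0)"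
      by (intro tendsto_intros)
    ultimately show "\<forall>\<^sub>F \<alpha> in at_right \<alpha>\<^sub>0.
        \<alpha> * (real s + real t - real j) < real s * real t - real (j choose 2)"
      by (rule order_tendstoD(2)[rotated])
  qed simp
  moreover have "\<forall>\<^sub>F \<alpha> in at_right \<alpha>\<^sub>0. \<alpha>\<^sub>0 < \<alpha>" by (rule eventually_at_right_less)
  ultimately have "\<forall>\<^sub>F \<alpha> in at_right \<alpha>\<^sub>0. \<alpha>\<^sub>0 < \<alpha> \<and> (\<forall>j\<in>{2..r}.
      \<alpha> * (real s + real t - real j) < real s * real t - real (j choose 2))"
    by eventually_elim blast
  then obtain \<alpha> where "\<alpha>\<^sub>0 < \<alpha>" "\<forall>j\<in>{2..r}.
      \<alpha> * (real s + real t - real j) < real s * real t - real (j choose 2)"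
    using eventually_happens'[OF trivial_limit_at_right_real] by blast
  then show "\<exists>\<alpha>>\<alpha>\<^sub>0. \<forall>j. 2 \<le> j \<longrightarrow> j \<le> r \<longrightarrow>
      \<alpha> * (real s + real t - real j) < real s * real t - real (j choose 2)"
    by (intro exI[of _ \<alpha>]) auto
qed

text \<open>The parameter \<open>m\<close> is chosen from \<open>p\<close> so that the bound on the
  \<open>u\<close>-cliques is at most \<open>p\<close>; the \<open>r\<close>-cliques then number at
  least a constant times \<open>p powr (N / D)\<close>, with \<open>N / D\<close> strictly above the
  target exponent.\<close>

lemma eventually_clique_ex_ge:
  fixes r u s t :: nat
  assumes u: "2 \<le> u" "u < r" and s: "r choose 2 \<le> s" "2 * r - 2 \<le> s" "s \<le> t"
  defines "\<alpha>\<^sub>0 \<equiv> (real s * real t - real (r choose 2)) / (real s + real t - 2)"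
  shows "\<forall>\<^sub>F p in sequentially.
    real p powr ((real r * \<alpha>\<^sub>0 - real (r choose 2)) / (real u * \<alpha>\<^sub>0 - real (u choose 2)))
      \<le> real (clique_ex u p r (complete_bipartite_digraph s t))"
proof -
  have r: "3 \<le> r" using u by simp
  have ge: "real r - 1 \<le> \<alpha>\<^sub>0" unfolding \<alpha>\<^sub>0_def using exists_exponent(1)[OF r s] .
  \<comment> \<open>The exponent increases strictly with \<open>\<alpha>\<close>, so any admissible \<open>\<alpha> > \<alpha>\<^sub>0\<close> absorbs all constants.\<close>
  obtain \<alpha> where \<alpha>: "\<alpha>\<^sub>0 < \<alpha>" and sparse: "\<And>j. 2 \<le> j \<Longrightarrow> j \<le> r \<Longrightarrow>
      \<alpha> * (real s + real t - real j) < real s * real t - real (j choose 2)"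
    using exists_exponent(2)[OF r s] unfolding \<alpha>\<^sub>0_def by blast
  let ?R = "real (r choose 2)" and ?U = "real (u choose 2)"
  define N where "N = real r * \<alpha> - ?R"
  define D where "D = real u * \<alpha> - ?U"
  define e where "e = (real r * \<alpha>\<^sub>0 - ?R) / (real u * \<alpha>\<^sub>0 - ?U)"
  define K where "K = 4 * exp (1 + real r)"
  define c where "c = 1 / (2 * (2 * real r) ^ r)"
  have Kc: "0 < K" "0 < c" using r by (auto simp: K_def c_def)
  have pos: "0 < real k * \<beta> - real (k choose 2)" if "\<alpha>\<^sub>0 \<le> \<beta>" "2 \<le> k" "k \<le> r" for k \<beta>
  proof -
    have "real k * ((real k - 1) / 2) < real k * \<beta>"
      using that ge by (intro mult_strict_left_mono) auto
    then show ?thesis by (simp add: real_choose_two)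
  qed
  have D: "0 < D" and N: "0 < N" and D0: "0 < real u * \<alpha>\<^sub>0 - ?U"
    unfolding D_def N_def using \<alpha> u by (intro pos; simp)+
  \<comment> \<open>After cross-multiplication the difference is
    \<open>(\<alpha> - \<alpha>\<^sub>0) * (u * ?R - r * ?U)\<close>, positive because
    \<open>u < r\<close>.\<close>
  have e_less: "e < N / D"
  proof -
    have "real r * ?U < real u * ?R"
    proof -
      have "real r * real u * (real u - 1) < real r * real u * (real r - 1)"
        using u by (intro mult_strict_left_mono) auto
      then show ?thesis by (simp add: real_choose_two field_simps)
    qed
    then have "0 < (\<alpha> - \<alpha>\<^sub>0) * (real u * ?R - real r * ?U)" using \<alpha> by simp
    then have "(real r * \<alpha>\<^sub>0 - ?R) * D < N * (real u * \<alpha>\<^sub>0 - ?U)"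
      unfolding D_def N_def by (simp add: algebra_simps)
    then show ?thesis unfolding e_def using D D0 by (simp add: divide_less_eq less_divide_eq field_simps)
  qed
  \<comment> \<open>\<open>x p\<close> solves \<open>K * x powr D = p\<close>; rounding down keeps
    the \<open>u\<close>-clique bound below \<open>p\<close>.\<close>
  define x where "x p = (real p / K) powr (1 / D)" for p
  define m where "m p = nat \<lfloor>x p\<rfloor>" for p
  have x_lim: "filterlim x at_top sequentially"
  proof -
    have "filterlim (\<lambda>p. real p / K) at_top sequentially"
      using filterlim_tendsto_pos_mult_at_top[OF tendsto_const[of "1 / K"] _ filterlim_real_sequentially] Kc
      by simp
    then show ?thesis unfolding x_def using D by (intro filterlim_compose[OF real_powr_at_top]) auto
  qed
  have m_lim: "filterlim m sequentially sequentially"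
    unfolding m_def
    by (intro filterlim_compose[OF filterlim_nat_sequentially]
        filterlim_compose[OF filterlim_floor_sequentially] x_lim)
  have "r \<le> s" using s r by linarith
  have "\<forall>\<^sub>F m in sequentially. \<exists>G :: nat pair_pre_digraph. pair_graph G \<and> \<not> has_biclique s t G \<and>
      real (card (cliques u G)) \<le> K * real m powr D \<and> c * real m powr N \<le> real (card (cliques r G))"
    unfolding K_def D_def c_def N_def
    using \<alpha> ge sparse by (intro eventually_sparse_graph[OF u s(1) \<open>r \<le> s\<close> s(3)]) auto
  then have "\<forall>\<^sub>F p in sequentially. \<exists>G :: nat pair_pre_digraph. pair_graph G \<and> \<not> has_biclique s t G \<and>
      real (card (cliques u G)) \<le> K * real (m p) powr D \<and> c * real (m p) powr N \<le> real (card (cliques r G))"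
    by (rule eventually_compose_filterlim[OF _ m_lim])
  moreover have "\<forall>\<^sub>F p in sequentially. 1 \<le> x p" using x_lim by (simp add: filterlim_at_top)
  \<comment> \<open>The factor \<open>2 powr N\<close> is the loss from rounding, and
    \<open>K powr (N / D)\<close> comes from solving for \<open>x p\<close>.\<close>
  moreover have "\<forall>\<^sub>F p in sequentially.
      1 * real p powr e \<le> c / (2 powr N * K powr (N / D)) * real p powr (N / D)"
    using e_less Kc by (intro eventually_mult_powr_le) auto
  ultimately show ?thesis
    unfolding e_def[symmetric]
  proof eventually_elim
    case (elim p)
    obtain G :: "nat pair_pre_digraph" where G: "pair_graph G" "\<not> has_biclique s t G"
      "real (card (cliques u G)) \<le> K * real (m p) powr D" "c * real (m p) powr N \<le> real (card (cliques r G))"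
      using elim(1) by blast
    have mx: "real (m p) \<le> x p" "x p / 2 \<le> real (m p)"
      unfolding m_def using elim(2) half_le_floor by auto
    have x_powr: "x p powr a = real p powr (a / D) / K powr (a / D)" for a
      unfolding x_def using Kc by (simp add: powr_powr powr_divide)
    have "K * real (m p) powr D \<le> K * x p powr D"
      using mx D Kc by (intro mult_left_mono powr_mono2) auto
    also have "\<dots> = real p" unfolding x_powr using D Kc by simp
    finally have "card (cliques u G) \<le> p" using G(3) by linarith
    then have "card (cliques r G) \<le> clique_ex u p r (complete_bipartite_digraph s t)"
      using u s r G by (intro clique_ex_ge_of_le) auto
    then have ex: "real (card (cliques r G)) \<le> real (clique_ex u p r (complete_bipartite_digraph s t))"
      by simp
    have "real p powr e \<le> c / (2 powr N * K powr (N / D)) * real p powr (N / D)" using elim(3) by simp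
    also have "\<dots> = c * (x p / 2) powr N"
      using elim(2) by (simp add: powr_divide x_powr)
    also have "\<dots> \<le> c * real (m p) powr N"
      using mx elim(2) N Kc by (intro mult_left_mono powr_mono2) auto
    finally show "real p powr e \<le> real (clique_ex u p r (complete_bipartite_digraph s t))"
      using G(4) ex by linarith
  qed
qed

text \<open>The constant 1 suffices, since the construction beats the exponent strictly and only
  large \<open>p\<close>, depending on \<open>s\<close> and \<open>t\<close>, matter.\<close>

theorem theorem4p3:
  fixes r u :: nat
  assumes "2 \<le> u" and "u < r"
  shows "\<exists>C::real. C > 0 \<and>
    (\<forall>s t :: nat. max (r choose 2) (2 * r - 2) \<le> s \<and> s \<le> t \<longrightarrow>
      (\<forall>\<^sub>F p in sequentially.
        real (clique_ex u p r (complete_bipartite_digraph s t)) \<ge>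
          C * real p powr
            ((2 * real r * real s * real t - real r * (real r - 1) * (real s + real t)
                - real r * (real r - 1) * (real r - 2)) /
             (2 * real u * real s * real t - real u * (real u - 1) * (real s + real t)
                - real u * real r * (real r - 1) + 2 * real u * (real u - 1)))))"
proof (intro exI[of _ 1] conjI allI impI)
  fix s t :: nat assume "max (r choose 2) (2 * r - 2) \<le> s \<and> s \<le> t"
  then have s: "r choose 2 \<le> s" "2 * r - 2 \<le> s" "s \<le> t" by auto
  define w where "w = real s + real t - 2"
  define \<alpha>\<^sub>0 where "\<alpha>\<^sub>0 = (real s * real t - real (r choose 2)) / w"
  have "4 \<le> s" using s assms by linarith
  then have w: "0 < w" using s unfolding w_def by linarith
  have \<alpha>: "w * \<alpha>\<^sub>0 = real s * real t - real (r choose 2)" using w by (simp add: \<alpha>\<^sub>0_def)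
  \<comment> \<open>Multiplying by \<open>2 * w\<close> clears the denominators of
    \<open>\<alpha>\<^sub>0\<close> and of the binomial coefficient; \<open>k = r\<close> and
    \<open>k = u\<close> give the numerator and denominator of the stated exponent.\<close>
  have mult: "2 * w * (real k * \<alpha>\<^sub>0 - real (k choose 2)) =
      2 * real k * (real s * real t - real (r choose 2)) - real k * (real k - 1) * w" for k
    unfolding \<alpha>[symmetric] by (simp add: real_choose_two[of k] field_simps)
  have "(2 * real r * real s * real t - real r * (real r - 1) * (real s + real t)
        - real r * (real r - 1) * (real r - 2)) /
      (2 * real u * real s * real t - real u * (real u - 1) * (real s + real t)
        - real u * real r * (real r - 1) + 2 * real u * (real u - 1))
    = (2 * w * (real r * \<alpha>\<^sub>0 - real (r choose 2))) / (2 * w * (real u * \<alpha>\<^sub>0 - real (u choose 2)))"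
    unfolding mult by (rule arg_cong2[of _ _ _ _ "(/)"]) (simp_all add: w_def real_choose_two field_simps)
  also have "\<dots> = (real r * \<alpha>\<^sub>0 - real (r choose 2)) / (real u * \<alpha>\<^sub>0 - real (u choose 2))"
    using w by simp
  finally show "\<forall>\<^sub>F p in sequentially.
        real (clique_ex u p r (complete_bipartite_digraph s t)) \<ge>
          1 * real p powr
            ((2 * real r * real s * real t - real r * (real r - 1) * (real s + real t)
                - real r * (real r - 1) * (real r - 2)) /
             (2 * real u * real s * real t - real u * (real u - 1) * (real s + real t)
                - real u * real r * (real r - 1) + 2 * real u * (real u - 1)))"
    using eventually_clique_ex_ge[OF assms s] by (simp add: \<alpha>\<^sub>0_def w_def)
qed simp

end
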